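(* Let $X$ be a Banach space. Then every cancellative sequence $(F_i)_{i=1}^\infty$ of sets in $X$ is admissible for testing compactness.
   Context: A "subsequence $f_{i(k)}\in F_{i(k)}$" means a choice of strictly increasing indices $i(1)<i(2)<\cdots$ together with a choice of $f_{i(k)}\in F_{i(k)}$ for each $k$. Cancellative: a sequence $(F_i)$ of sets in $X$ is called cancellative if every subsequence $f_{i_1(k)}\in F_{i_1(k)}$ has a further subsequence $f_{i_2(k)}$ that Cesàro sums to zero in norm, i.e. $\lim_{K\to\infty}\frac1K\big\|\sum_{k=1}^K f_{i_2(k)}\big\|_X=0$. Admissible for testing compactness: $\limsup_{i\to\infty}\sup_{f_i\in F_i}\|Tf_i\|_Y=0$ for every Banach space $Y$ (over the same scalar field as $X$) and every compact linear operator $T:X\to Y$. The supremum of nonnegative quantities over an empty set is $0$. *)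

theory Defs
  imports "HOL-Analysis.Analysis"
begin

text \<open>
  Normed spaces over the scalar field \<open>'k\<close>. By the Gelfand--Mazur theorem, a type of class
  \<^class>\<open>real_normed_field\<close> is a copy of the real or of the complex numbers, so this covers real and
  complex spaces at once. The addition, norm and real scalar multiplication are those of the type
  class, which for \<open>'k = real\<close> forces the scalar multiplication to be \<^term>\<open>scaleR\<close>. Completeness does
  not depend on the scalars: Banach spaces are obtained by using a carrier of class \<^class>\<open>banach\<close>.
\<close>

locale normed_space_over = vector_space scale
  for scale :: "'k::real_normed_field \<Rightarrow> 'a::real_normed_vector \<Rightarrow> 'a" +
  assumes scale_of_real: "scale (of_real r) x = r *\<^sub>R x"
    and norm_scale: "norm (scale c x) = norm c * norm x"

lemma normed_space_over_scaleR:
  "normed_space_over (scaleR :: real \<Rightarrow> 'a::real_normed_vector \<Rightarrow> 'a)"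
  by unfold_locales (simp_all add: algebra_simps)

lemma normed_space_over_mult:
  "normed_space_over ((*) :: 'k::real_normed_field \<Rightarrow> 'k \<Rightarrow> 'k)"
  by unfold_locales (simp_all add: algebra_simps norm_mult scaleR_conv_of_real)

definition compact_operator ::
  "('k::real_normed_field \<Rightarrow> 'a::real_normed_vector \<Rightarrow> 'a) \<Rightarrow>
   ('k \<Rightarrow> 'b::real_normed_vector \<Rightarrow> 'b) \<Rightarrow> ('a \<Rightarrow> 'b) \<Rightarrow> bool"
  where "compact_operator scaleX scaleY T \<longleftrightarrow>
    Vector_Spaces.linear scaleX scaleY T \<and> (\<forall>B. bounded B \<longrightarrow> compact (closure (T ` B)))"

definition subsequence_of :: "(nat \<Rightarrow> 'a) \<Rightarrow> (nat \<Rightarrow> 'a set) \<Rightarrow> bool"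
  where "subsequence_of f F \<longleftrightarrow> (\<exists>i. strict_mono i \<and> (\<forall>k. f k \<in> F (i k)))"

definition cesaro_sums_to_zero :: "(nat \<Rightarrow> 'a::real_normed_vector) \<Rightarrow> bool"
  where "cesaro_sums_to_zero f \<longleftrightarrow> (\<lambda>K. 1 / real K * norm (\<Sum>k<K. f k)) \<longlonglongrightarrow> 0"

definition cancellative :: "(nat \<Rightarrow> 'a::real_normed_vector set) \<Rightarrow> bool"
  where "cancellative F \<longleftrightarrow>
    (\<forall>f. subsequence_of f F \<longrightarrow> (\<exists>s. strict_mono s \<and> cesaro_sums_to_zero (f \<circ> s)))"

text \<open>
  A formula cannot quantify over types, so the carrier type \<open>'b\<close> of the target space is a parameter;
  a theorem about \<open>TYPE('b)\<close> with \<open>'b\<close> a type variable is a statement about all target spaces.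
  The supremum is taken in \<^typ>\<open>ennreal\<close>: it may be infinite, and it is \<open>0\<close> over the empty set.
\<close>

definition admissible_for_compactness ::
  "('k::real_normed_field \<Rightarrow> 'a::banach \<Rightarrow> 'a) \<Rightarrow> 'b::banach itself \<Rightarrow> (nat \<Rightarrow> 'a set) \<Rightarrow> bool"
  where "admissible_for_compactness scaleX (_ :: 'b itself) F \<longleftrightarrow>
    (\<forall>(scaleY :: 'k \<Rightarrow> 'b \<Rightarrow> 'b) (T :: 'a \<Rightarrow> 'b).
      normed_space_over scaleY \<longrightarrow> compact_operator scaleX scaleY T \<longrightarrow>
      limsup (\<lambda>i. SUP f\<in>F i. ennreal (norm (T f))) = 0)"

end

theory Submission
  imports Defs
begin

text \<open>
  A cancellative sequence of sets has only bounded subsequences: if \<open>norm (f k) \<ge> k\<close> along a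
  subsequence, the same holds along any further one, contradicting \<open>f K / K \<longlongrightarrow> 0\<close>. If the limsup
  were positive, there would thus be a bounded subsequence \<open>f\<close> with \<open>norm (T (f k)) > \<epsilon>\<close>; by
  compactness, \<open>T \<circ> f\<close> may be taken to stay within \<open>\<epsilon>/3\<close> of some \<open>y\<close> with \<open>norm y \<ge> \<epsilon>\<close>. Every Cesaro
  mean of \<open>T \<circ> f\<close> along a further subsequence is then within \<open>\<epsilon>/3\<close> of \<open>y\<close>, hence not small.
\<close>

lemma subsequence_of_comp:
  assumes "subsequence_of f F" "strict_mono r"
  shows "subsequence_of (f \<circ> r) F"
proof -
  obtain i where "strict_mono i" "\<forall>k. f k \<in> F (i k)"
    using assms(1) by (auto simp: subsequence_of_def)
  then have "strict_mono (i \<circ> r) \<and> (\<forall>k. (f \<circ> r) k \<in> F ((i \<circ> r) k))"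
    using assms(2) by (auto intro: strict_mono_o)
  then show ?thesis unfolding subsequence_of_def by blast
qed

text \<open>Extracts a subsequence by dependent choice. The property may vary with the position
  \<open>k\<close>, which allows the growing thresholds needed to exploit unboundedness.\<close>

lemma strict_mono_choice:
  fixes P :: "nat \<Rightarrow> nat \<Rightarrow> bool"
  assumes "\<And>k n. \<exists>m>n. P k m"
  obtains r where "strict_mono r" "\<And>k. P k (r k)"
proof -
  have "\<exists>r. \<forall>k. P k (r k) \<and> r k < r (Suc k)"
  proof (rule dependent_nat_choice)
    show "\<exists>m. P 0 m" using assms[of 0 0] by auto
    show "\<exists>m'. P (Suc k) m' \<and> m < m'" for m k using assms[of m "Suc k"] by auto
  qed
  then show thesis using that by (auto simp: strict_mono_Suc_iff)
qed

text \<open>A single term is the difference of two consecutive partial sums, so after division by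
  \<open>Suc K\<close> it is dominated by two consecutive Cesaro means.\<close>

lemma cesaro_sums_to_zero_imp_term_div:
  assumes "cesaro_sums_to_zero f"
  shows "(\<lambda>K. norm (f K) / real (Suc K)) \<longlonglongrightarrow> 0"
proof -
  let ?a = "\<lambda>K. 1 / real K * norm (\<Sum>k<K. f k)"
  have a: "?a \<longlonglongrightarrow> 0" using assms by (simp add: cesaro_sums_to_zero_def)
  then have lim: "(\<lambda>K. ?a (Suc K) + ?a K) \<longlonglongrightarrow> 0"
    using tendsto_add[OF LIMSEQ_Suc[OF a] a] by simp
  have "norm (f K) / real (Suc K) \<le> ?a (Suc K) + ?a K" for K
  proof -
    have "norm (f K) \<le> norm (\<Sum>k<Suc K. f k) + norm (\<Sum>k<K. f k)"
      using norm_triangle_ineq4[of "\<Sum>k<Suc K. f k" "\<Sum>k<K. f k"] by simp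
    then have "norm (f K) / real (Suc K) \<le> ?a (Suc K) + norm (\<Sum>k<K. f k) / real (Suc K)"
      by (simp add: divide_right_mono flip: add_divide_distrib)
    also have "norm (\<Sum>k<K. f k) / real (Suc K) \<le> ?a K"
      by (cases "K = 0") (simp_all add: frac_le)
    finally show ?thesis by simp
  qed
  then show ?thesis
    by (intro tendsto_sandwich[OF _ _ tendsto_const lim] always_eventually allI) auto
qed

lemma cancellative_imp_bounded:
  assumes "cancellative F" "subsequence_of f F"
  shows "bounded (range f)"
proof (rule ccontr)
  assume unbounded: "\<not> bounded (range f)"
  \<comment> \<open>Removing finitely many terms cannot make the range bounded, so large terms occur
    beyond every index.\<close>
  have "\<exists>m>n. norm (f m) \<ge> real (Suc k)" for k n
  proof (rule ccontr)
    assume "\<not> ?thesis"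
    then have "f ` {n<..} \<subseteq> cball 0 (Suc k)" by auto
    then have "bounded (f ` {..n} \<union> f ` {n<..})"
      by (auto intro: finite_imp_bounded bounded_subset[OF bounded_cball])
    moreover have "range f = f ` {..n} \<union> f ` {n<..}"
      by (simp only: image_Un[symmetric] Compl_atMost[symmetric] Compl_partition)
    ultimately show False using unbounded by simp
  qed
  then obtain r where r: "strict_mono r" "\<And>k. norm (f (r k)) \<ge> real (Suc k)"
    using strict_mono_choice[of "\<lambda>k m. norm (f m) \<ge> real (Suc k)"] by metis
  obtain s where s: "strict_mono s" "cesaro_sums_to_zero (f \<circ> r \<circ> s)"
    using assms(1) subsequence_of_comp[OF assms(2) r(1)] by (auto simp: cancellative_def)
  have "(\<lambda>K. norm ((f \<circ> r \<circ> s) K) / real (Suc K)) \<longlonglongrightarrow> 0"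
    by (rule cesaro_sums_to_zero_imp_term_div) fact
  \<comment> \<open>Thinning out by \<open>s\<close> only helps: \<open>K \<le> s K\<close>, so the
    lower bound \<open>Suc (s K)\<close> is at least \<open>Suc K\<close>.\<close>
  moreover have "1 \<le> norm ((f \<circ> r \<circ> s) K) / real (Suc K)" for K
    using r(2)[of "s K"] seq_suble[OF s(1), of K] by (simp add: le_divide_eq)
  ultimately have "1 \<le> (0::real)"
    by (intro LIMSEQ_le_const) auto
  then show False by simp
qed

text \<open>The image of the unit ball lies in a compact set, hence is bounded, and rescaling gives
  the operator bound. Real homogeneity comes from scalars of the form \<open>of_real r\<close>, on
  which both scalings agree with \<open>scaleR\<close>.\<close>

lemma compact_operator_imp_bounded_linear:
  fixes T :: "'a::real_normed_vector \<Rightarrow> 'b::real_normed_vector"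
  assumes "normed_space_over scaleX" "normed_space_over scaleY"
    and "compact_operator scaleX scaleY T"
  shows "bounded_linear T"
proof -
  interpret T: Vector_Spaces.linear scaleX scaleY T
    using assms(3) by (simp add: compact_operator_def)
  have scaleR: "T (r *\<^sub>R x) = r *\<^sub>R T x" for r x
    using T.scale[of "of_real r" x] assms(1,2) by (simp add: normed_space_over.scale_of_real)
  have "bounded (T ` cball 0 1)"
    using assms(3) unfolding compact_operator_def
    by (meson bounded_cball bounded_subset closure_subset compact_imp_bounded)
  then obtain C where "\<forall>y\<in>T ` cball 0 1. norm y \<le> C"
    unfolding bounded_iff by blast
  then have C: "norm (T x) \<le> C" if "norm x \<le> 1" for x
    using that by simp
  show ?thesis
  proof (rule bounded_linear_intro)
    fix x
    have "norm x *\<^sub>R T (x /\<^sub>R norm x) = T x"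
      by (cases "x = 0") (simp_all add: T.zero flip: scaleR)
    then have "norm (T x) = norm x * norm (T (x /\<^sub>R norm x))"
      by (metis abs_norm_cancel norm_scaleR)
    also have "\<dots> \<le> norm x * C"
      by (intro mult_left_mono C) (cases "x = 0"; simp)+
    finally show "norm (T x) \<le> norm x * C" .
  qed (rule T.add scaleR)+
qed

text \<open>\<open>T\<close> commutes with finite sums, so the means for \<open>T \<circ> f\<close>
  are at most \<open>C\<close> times those for \<open>f\<close>.\<close>

lemma cesaro_sums_to_zero_bounded_linear:
  assumes "bounded_linear T" "cesaro_sums_to_zero f"
  shows "cesaro_sums_to_zero (T \<circ> f)"
proof -
  interpret bounded_linear T by fact
  obtain C where C: "\<And>x. norm (T x) \<le> norm x * C" using bounded by blast
  have lim: "(\<lambda>K. 1 / real K * norm (\<Sum>k<K. f k) * C) \<longlonglongrightarrow> 0"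
    using assms(2) tendsto_mult_left_zero unfolding cesaro_sums_to_zero_def by blast
  have "1 / real K * norm (\<Sum>k<K. (T \<circ> f) k) \<le> 1 / real K * norm (\<Sum>k<K. f k) * C" for K
    using C[of "\<Sum>k<K. f k"] by (simp add: divide_right_mono sum)
  then show ?thesis unfolding cesaro_sums_to_zero_def
    by (intro tendsto_sandwich[OF _ _ tendsto_const lim] always_eventually allI) auto
qed

text \<open>Averaging preserves closeness to \<open>y\<close>, so every mean over at least one term
  has norm at least \<open>norm y - d\<close>, a fixed positive number.\<close>

lemma not_cesaro_sums_to_zero_if_close:
  assumes "\<And>k. norm (g k - y) \<le> d" "d < norm y"
  shows "\<not> cesaro_sums_to_zero g"
proof
  assume "cesaro_sums_to_zero g"
  moreover have "norm y - d \<le> 1 / real K * norm (\<Sum>k<K. g k)" if "K \<ge> 1" for K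
  proof -
    have "(\<Sum>k<K. g k) = (\<Sum>k<K. g k - y) + real K *\<^sub>R y"
      by (simp add: sum_subtractf sum_constant_scaleR)
    moreover have "norm (\<Sum>k<K. g k - y) \<le> real K * d"
      using sum_norm_le[of "{..<K}" "\<lambda>k. g k - y" "\<lambda>_. d"] assms(1) by simp
    ultimately have "real K * (norm y - d) \<le> norm (\<Sum>k<K. g k)"
      using norm_diff_ineq[of "real K *\<^sub>R y" "\<Sum>k<K. g k - y"]
      by (simp add: algebra_simps)
    then show ?thesis using that by (simp add: field_simps)
  qed
  ultimately have "norm y - d \<le> 0"
    unfolding cesaro_sums_to_zero_def by (intro LIMSEQ_le_const) auto
  then show False using assms(2) by simp
qed

lemma compact_operator_subseq_convergent:
  fixes f :: "nat \<Rightarrow> 'a::real_normed_vector"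
  assumes "compact_operator scaleX scaleY T" "bounded (range f)"
  obtains y r where "strict_mono r" "(T \<circ> f \<circ> r) \<longlonglongrightarrow> y"
proof -
  have "seq_compact (closure (T ` range f))"
    using assms by (simp add: compact_operator_def compact_imp_seq_compact)
  moreover have "\<forall>n. (T \<circ> f) n \<in> closure (T ` range f)"
    by (simp add: closure_subset[THEN subsetD])
  ultimately obtain l r where "strict_mono r" "(T \<circ> f \<circ> r) \<longlonglongrightarrow> l"
    by (rule seq_compactE)
  then show thesis by (rule that)
qed

lemma limsup_pos_imp_subsequence:
  fixes T :: "'a \<Rightarrow> 'b::real_normed_vector"
  assumes "limsup (\<lambda>i. SUP f\<in>F i. ennreal (norm (T f))) \<noteq> 0"
  obtains f e where "subsequence_of f F" "e > 0" "\<And>k. e < norm (T (f k))"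
proof -
  let ?S = "\<lambda>i. SUP f\<in>F i. ennreal (norm (T f))"
  have "0 < limsup ?S" using assms by (simp add: zero_less_iff_neq_zero)
  then obtain c where c: "0 < c" "c < limsup ?S" using dense by blast
  \<comment> \<open>Even if the limsup is infinite, \<open>c\<close> lies strictly below it and is
    therefore a real number.\<close>
  then obtain e where e: "c = ennreal e" "e \<ge> 0" by (cases c) auto
  have "\<not> (\<forall>\<^sub>F i in sequentially. ?S i \<le> c)"
    using c(2) Limsup_bounded[of ?S c sequentially] by (auto simp: not_le[symmetric])
  then have "\<exists>m\<ge>n. \<exists>f\<in>F m. e < norm (T f)" for n
    using e by (auto simp: eventually_sequentially not_le less_SUP_iff ennreal_less_iff)
  then have "\<exists>m>n. \<exists>f\<in>F m. e < norm (T f)" for n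
    by (metis Suc_le_lessD)
  then obtain i :: "nat \<Rightarrow> nat"
    where i: "strict_mono i" "\<And>k. \<exists>f\<in>F (i k). e < norm (T f)"
    using strict_mono_choice[of "\<lambda>_ m. \<exists>f\<in>F m. e < norm (T f)"] by metis
  then obtain f where "\<And>k. f k \<in> F (i k)" "\<And>k. e < norm (T (f k))" by metis
  moreover have "e > 0" using c(1) e by simp
  ultimately show thesis using i(1) that unfolding subsequence_of_def by blast
qed

theorem lemma3p2:
  fixes scaleX :: "'k::real_normed_field \<Rightarrow> 'a::banach \<Rightarrow> 'a"
    and F :: "nat \<Rightarrow> 'a set"
  assumes "normed_space_over scaleX"
    and "cancellative F"
  shows "admissible_for_compactness scaleX TYPE('b::banach) F"
  unfolding admissible_for_compactness_def
proof (intro allI impI, rule ccontr)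
  fix scaleY :: "'k \<Rightarrow> 'b \<Rightarrow> 'b" and T :: "'a \<Rightarrow> 'b"
  assume Y: "normed_space_over scaleY" and T: "compact_operator scaleX scaleY T"
    and "limsup (\<lambda>i. SUP f\<in>F i. ennreal (norm (T f))) \<noteq> 0"
  then obtain f e where f: "subsequence_of f F" and e: "e > 0" "\<And>k. e < norm (T (f k))"
    using limsup_pos_imp_subsequence by blast
  obtain y r where r: "strict_mono r" and y: "(T \<circ> f \<circ> r) \<longlonglongrightarrow> y"
    using compact_operator_subseq_convergent[OF T cancellative_imp_bounded[OF assms(2) f]] .
  have "e \<le> norm y"
    using tendsto_norm[OF y] e(2) by (intro LIMSEQ_le_const) (auto intro: less_imp_le)
  obtain N where N: "\<And>k. k \<ge> N \<Longrightarrow> norm ((T \<circ> f \<circ> r) k - y) < e / 3"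
    using LIMSEQ_D[OF y, of "e / 3"] e(1) by auto
  \<comment> \<open>Dropping the first \<open>N\<close> terms makes the \<open>e / 3\<close>
    estimate hold at every index, hence along whatever further subsequence cancellativity
    provides.\<close>
  have "strict_mono (\<lambda>k. r (k + N))" using r by (simp add: strict_mono_def)
  from subsequence_of_comp[OF f this] assms(2) obtain s where
    "cesaro_sums_to_zero (f \<circ> (\<lambda>k. r (k + N)) \<circ> s)" unfolding cancellative_def by blast
  from cesaro_sums_to_zero_bounded_linear[OF
      compact_operator_imp_bounded_linear[OF assms(1) Y T] this]
  have "cesaro_sums_to_zero (T \<circ> (f \<circ> (\<lambda>k. r (k + N)) \<circ> s))" .
  moreover have "norm ((T \<circ> (f \<circ> (\<lambda>k. r (k + N)) \<circ> s)) k - y) \<le> e / 3" for k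
    using N[of "s k + N"] by simp
  ultimately show False
    using not_cesaro_sums_to_zero_if_close[of _ y "e / 3"] e(1) \<open>e \<le> norm y\<close> by simp
qed

end
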